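(* Let $H$ and $K$ be separable Hilbert spaces, and let $V=\{(V_i,v_i)\}_{i\in I}$ and $W=\{(W_j,w_j)\}_{j\in J}$ be fusion frames for $H$ and $K$ with bounds $(A,B)$ and $(C,D)$, respectively. If $T_1$ and $T_2$ are invertible and unitary operators on $H$ and $K$, respectively, then $$\Delta=\{((T_1\otimes T_2)(V_i\otimes W_j),\,v_iw_j)\}_{(i,j)\in I\times J}$$ is a fusion frame for $H\otimes K$.
   Context: $H\otimes K$ is the Hilbert space tensor product, with $\langle f\otimes g,f'\otimes g'\rangle=\langle f,f'\rangle\langle g,g'\rangle$; $V_i\otimes W_j$ is the closed subspace of $H\otimes K$ given by the tensor product of the closed subspaces $V_i\subset H$ and $W_j\subset K$. $P_X$ denotes the orthogonal projection onto a closed subspace $X$. For bounded operators $Q$ on $H$ and $T$ on $K$, $Q\otimes T$ is the bounded operator on $H\otimes K$ with $(Q\otimes T)(f\otimes g)=Qf\otimes Tg$. An operator $T$ is called unitary here if $T^*T$ is the identity. A family $V=\{(V_i,v_i)\}_{i\in I}$ of closed subspaces of $H$ with weights $v_i>0$ is a fusion frame for $H$ with bounds $(A,B)$, $0<A\le B<\infty$, if $A\|f\|^2\le\sum_{i\in I}v_i^2\|P_{V_i}f\|^2\le B\|f\|^2$ for all $f\in H$ (similarly for $K$). A family $\{(X_{ij},v_iw_j)\}_{i,j}$ of closed subspaces $X_{ij}$ of $H\otimes K$ with positive weights $v_iw_j$ is a fusion frame for $H\otimes K$ if there exist constants $0<A'\le B'<\infty$ such that $A'\|f\otimes g\|^2\le\sum_{i,j}v_i^2w_j^2\|P_{X_{ij}}(f\otimes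 g)\|^2\le B'\|f\otimes g\|^2$ for all $f\otimes g\in H\otimes K$ (i.e. for all $f\in H$, $g\in K$). *)

theory Defs
  imports "HOL-Analysis.Analysis"
begin

text \<open>
  The scalar field is \<open>real\<close> or \<open>complex\<close>. Every commutative real normed field is isomorphic to
  one of them (Gelfand-Mazur), and the last axiom determines the conjugation.
\<close>

class rc_field = real_normed_field +
  fixes sconj :: "'a \<Rightarrow> 'a"
  assumes sconj_add: "sconj (x + y) = sconj x + sconj y"
    and sconj_mult: "sconj (x * y) = sconj x * sconj y"
    and mult_sconj: "x * sconj x = (norm x)\<^sup>2 *\<^sub>R 1"

instantiation real :: rc_field
begin

definition sconj_real :: "real \<Rightarrow> real" where "sconj_real x = x"

instance
  by standard (simp_all add: sconj_real_def power2_eq_square)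

end

instantiation complex :: rc_field
begin

definition sconj_complex :: "complex \<Rightarrow> complex" where "sconj_complex = cnj"

instance
  by standard (simp_all add: sconj_complex_def scaleR_conv_of_real flip: complex_norm_square)

end

text \<open>
  A Hilbert space over \<open>'k\<close> is a whole type: completeness, norm and topology come from the class
  \<open>banach\<close>, and the norm is required to be the one induced by the inner product, which is linear
  in its first argument.
\<close>

locale hilbert_space = vector_space smul
  for smul :: "'k::rc_field \<Rightarrow> 'a::banach \<Rightarrow> 'a" +
  fixes ip :: "'a \<Rightarrow> 'a \<Rightarrow> 'k"
  assumes smul_of_real: "smul (of_real r) x = r *\<^sub>R x"
    and ip_add_left: "ip (x + y) z = ip x z + ip y z"
    and ip_smul_left: "ip (smul a x) y = a * ip x y"
    and ip_sconj: "ip y x = sconj (ip x y)"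
    and ip_norm: "ip x x = of_real ((norm x)\<^sup>2)"

definition closed_subspace :: "('k::rc_field \<Rightarrow> 'a::banach \<Rightarrow> 'a) \<Rightarrow> 'a set \<Rightarrow> bool" where
  "closed_subspace smul X \<longleftrightarrow> module.subspace smul X \<and> closed X"

definition orth_proj :: "('a::banach \<Rightarrow> 'a \<Rightarrow> 'k::rc_field) \<Rightarrow> 'a set \<Rightarrow> 'a \<Rightarrow> 'a" where
  "orth_proj ip X f = (THE p. p \<in> X \<and> (\<forall>x\<in>X. ip (f - p) x = 0))"

definition bounded_op :: "('k::rc_field \<Rightarrow> 'a::banach \<Rightarrow> 'a) \<Rightarrow> ('a \<Rightarrow> 'a) \<Rightarrow> bool" where
  "bounded_op smul T \<longleftrightarrow> Vector_Spaces.linear smul smul T \<and> bounded_linear T"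

definition invertible_op :: "('k::rc_field \<Rightarrow> 'a::banach \<Rightarrow> 'a) \<Rightarrow> ('a \<Rightarrow> 'a) \<Rightarrow> bool" where
  "invertible_op smul T \<longleftrightarrow>
     bounded_op smul T \<and> (\<exists>S. bounded_op smul S \<and> S \<circ> T = id \<and> T \<circ> S = id)"

definition adjoint_op :: "('a::banach \<Rightarrow> 'a \<Rightarrow> 'k::rc_field) \<Rightarrow> ('a \<Rightarrow> 'a) \<Rightarrow> 'a \<Rightarrow> 'a" where
  "adjoint_op ip T = (THE S. \<forall>x y. ip (T x) y = ip x (S y))"

definition unitary_op ::
  "('k::rc_field \<Rightarrow> 'a::banach \<Rightarrow> 'a) \<Rightarrow> ('a \<Rightarrow> 'a \<Rightarrow> 'k) \<Rightarrow> ('a \<Rightarrow> 'a) \<Rightarrow> bool" where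
  "unitary_op smul ip T \<longleftrightarrow> bounded_op smul T \<and> adjoint_op ip T \<circ> T = id"

text \<open>
  Summability is required explicitly since \<open>infsum\<close> of a non-summable family is \<open>0\<close>.
\<close>

definition fusion_frame ::
  "('k::rc_field \<Rightarrow> 'a::banach \<Rightarrow> 'a) \<Rightarrow> ('a \<Rightarrow> 'a \<Rightarrow> 'k) \<Rightarrow>
    'i set \<Rightarrow> ('i \<Rightarrow> 'a set) \<Rightarrow> ('i \<Rightarrow> real) \<Rightarrow> real \<Rightarrow> real \<Rightarrow> bool" where
  "fusion_frame smul ip I V v A B \<longleftrightarrow>
     (\<forall>i\<in>I. closed_subspace smul (V i) \<and> v i > 0) \<and> 0 < A \<and> A \<le> B \<and>
     (\<forall>f. (\<lambda>i. (v i)\<^sup>2 * (norm (orth_proj ip (V i) f))\<^sup>2) summable_on I \<and>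
          A * (norm f)\<^sup>2 \<le> (\<Sum>\<^sub>\<infinity>i\<in>I. (v i)\<^sup>2 * (norm (orth_proj ip (V i) f))\<^sup>2) \<and>
          (\<Sum>\<^sub>\<infinity>i\<in>I. (v i)\<^sup>2 * (norm (orth_proj ip (V i) f))\<^sup>2) \<le> B * (norm f)\<^sup>2)"

text \<open>
  The Hilbert space tensor product, determined up to a unique unitary isomorphism compatible with
  the elementary tensors: the completion of the algebraic tensor product, i.e. a Hilbert space in
  which the elementary tensors have dense span.
\<close>

locale hilbert_tensor =
  H: hilbert_space smulH ipH + K: hilbert_space smulK ipK + HK: hilbert_space smulHK ipHK
  for smulH :: "'k::rc_field \<Rightarrow> 'a::banach \<Rightarrow> 'a" and ipH
    and smulK :: "'k \<Rightarrow> 'b::banach \<Rightarrow> 'b" and ipK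
    and smulHK :: "'k \<Rightarrow> 'c::banach \<Rightarrow> 'c" and ipHK +
  fixes tensor :: "'a \<Rightarrow> 'b \<Rightarrow> 'c"
  assumes tensor_linear_left: "Vector_Spaces.linear smulH smulHK (\<lambda>f. tensor f g)"
    and tensor_linear_right: "Vector_Spaces.linear smulK smulHK (\<lambda>g. tensor f g)"
    and ip_tensor: "ipHK (tensor f g) (tensor f' g') = ipH f f' * ipK g g'"
    and tensor_dense: "closure (module.span smulHK {tensor f g | f g. True}) = UNIV"

definition tensor_subspace ::
  "('k::rc_field \<Rightarrow> 'c::banach \<Rightarrow> 'c) \<Rightarrow> ('a::banach \<Rightarrow> 'b::banach \<Rightarrow> 'c) \<Rightarrow>
    'a set \<Rightarrow> 'b set \<Rightarrow> 'c set" where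
  "tensor_subspace smulHK tensor V W =
     closure (module.span smulHK {tensor f g | f g. f \<in> V \<and> g \<in> W})"

definition tensor_op ::
  "('k::rc_field \<Rightarrow> 'c::banach \<Rightarrow> 'c) \<Rightarrow> ('a::banach \<Rightarrow> 'b::banach \<Rightarrow> 'c) \<Rightarrow>
    ('a \<Rightarrow> 'a) \<Rightarrow> ('b \<Rightarrow> 'b) \<Rightarrow> 'c \<Rightarrow> 'c" where
  "tensor_op smulHK tensor Q T =
     (THE R. bounded_op smulHK R \<and> (\<forall>f g. R (tensor f g) = tensor (Q f) (T g)))"

text \<open>
  Fusion frames for the tensor product: the frame inequalities are imposed on elementary tensors
  only.
\<close>

definition tensor_fusion_frame ::
  "('k::rc_field \<Rightarrow> 'c::banach \<Rightarrow> 'c) \<Rightarrow> ('c \<Rightarrow> 'c \<Rightarrow> 'k) \<Rightarrow> ('a::banach \<Rightarrow> 'b::banach \<Rightarrow> 'c) \<Rightarrow>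
    'i set \<Rightarrow> 'j set \<Rightarrow> ('i \<Rightarrow> 'j \<Rightarrow> 'c set) \<Rightarrow> ('i \<Rightarrow> real) \<Rightarrow> ('j \<Rightarrow> real) \<Rightarrow> bool" where
  "tensor_fusion_frame smulHK ipHK tensor I J X v w \<longleftrightarrow>
     (\<forall>i\<in>I. \<forall>j\<in>J. closed_subspace smulHK (X i j) \<and> v i * w j > 0) \<and>
     (\<exists>A' B'. 0 < A' \<and> A' \<le> B' \<and>
       (\<forall>f g. let s = (\<lambda>(i, j). (v i)\<^sup>2 * (w j)\<^sup>2 * (norm (orth_proj ipHK (X i j) (tensor f g)))\<^sup>2) in
          s summable_on I \<times> J \<and>
          A' * (norm (tensor f g))\<^sup>2 \<le> infsum s (I \<times> J) \<and>
          infsum s (I \<times> J) \<le> B' * (norm (tensor f g))\<^sup>2))"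

end

theory Submission
  imports Defs
begin

text \<open>
  Existence of adjoints (Riesz) turns \<open>T\<^sup>* T = id\<close> into preservation of inner products. Hence
  \<open>T\<^sub>1 \<otimes> T\<^sub>2\<close> exists, because it preserves inner products on elementary tensors, and it is an
  isometry \<open>R\<close>. Projections satisfy \<open>P\<^bsub>R X\<^esub> R = R P\<^bsub>X\<^esub>\<close> and
  \<open>P\<^bsub>V \<otimes> W\<^esub> (f \<otimes> g) = P\<^bsub>V\<^esub> f \<otimes> P\<^bsub>W\<^esub> g\<close>. Writing \<open>f = T\<^sub>1 f'\<close> and \<open>g = T\<^sub>2 g'\<close>,
  the double sum for \<open>f \<otimes> g\<close> is the product of the frame sums of \<open>f'\<close> and \<open>g'\<close>, so \<open>AC\<close> and
  \<open>BD\<close> are frame bounds.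
\<close>

section \<open>Conjugation\<close>

lemma sconj_0 [simp]: "sconj (0::'k::rc_field) = 0"
  using sconj_add[of "0::'k" 0] by simp

lemma sconj_of_real [simp]: "sconj (of_real r :: 'k::rc_field) = of_real r"
proof (cases "r = 0")
  case False
  have "of_real r * sconj (of_real r :: 'k) = of_real r * of_real r"
    using mult_sconj[of "of_real r :: 'k"]
    by (simp add: scaleR_conv_of_real power2_eq_square flip: of_real_mult)
  then show ?thesis using False by simp
qed simp

lemma norm_sconj [simp]: "norm (sconj (x::'k::rc_field)) = norm x"
proof (cases "x = 0")
  case False
  have "norm x * norm (sconj x) = (norm x)\<^sup>2"
    using arg_cong[OF mult_sconj[of x], of norm] by (simp add: norm_mult)
  then show ?thesis using False by (simp add: power2_eq_square)
qed simp

text \<open>Real homogeneity comes from multiplicativity and \<open>sconj_of_real\<close>. This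
  gives continuity of the inner product in its second argument.\<close>

lemma bounded_linear_sconj: "bounded_linear (sconj :: 'k::rc_field \<Rightarrow> 'k)"
  by (rule bounded_linear_intro[where K = 1])
    (simp_all add: sconj_add sconj_mult scaleR_conv_of_real)

text \<open>By \<open>mult_sconj\<close> and equality of norms, \<open>x\<close> and
  \<open>sconj (sconj x)\<close> have the same product with \<open>sconj x\<close>, which cancels
  when \<open>x\<close> is non-zero.\<close>

lemma sconj_sconj [simp]: "sconj (sconj x) = (x::'k::rc_field)"
proof (cases "x = 0")
  case False
  have "sconj x * sconj (sconj x) = sconj x * x"
    using mult_sconj[of x] mult_sconj[of "sconj x"] by (simp add: mult.commute)
  moreover have "sconj x \<noteq> 0"
    using False by (metis norm_eq_zero norm_sconj)
  ultimately show ?thesis by simp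
qed simp

section \<open>Geometry of Hilbert spaces\<close>

context hilbert_space
begin

section \<open>Sesquilinearity and the Cauchy-Schwarz inequality\<close>

lemma ip_smul_right: "ip x (smul a y) = sconj a * ip x y"
  by (metis ip_sconj ip_smul_left sconj_mult)

lemma ip_add_right: "ip x (y + z) = ip x y + ip x z"
  by (metis ip_sconj ip_add_left sconj_add)

lemma ip_zero_left [simp]: "ip 0 x = 0"
  using ip_smul_left[of 0 0 x] by simp

lemma ip_zero_right [simp]: "ip x 0 = 0"
  using ip_smul_right[of x 0 0] by simp

lemma ip_minus_left: "ip (- x) y = - ip x y"
  using ip_add_left[of x "- x" y] by (simp add: add_eq_0_iff)

lemma ip_minus_right: "ip x (- y) = - ip x y"
  using ip_add_right[of x y "- y"] by (simp add: add_eq_0_iff)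

lemma ip_diff_left: "ip (x - y) z = ip x z - ip y z"
  using ip_add_left[of x "- y" z] by (simp add: ip_minus_left)

lemma ip_diff_right: "ip x (y - z) = ip x y - ip x z"
  using ip_add_right[of x y "- z"] by (simp add: ip_minus_right)

lemmas ip_simps = ip_add_left ip_add_right ip_diff_left ip_diff_right ip_smul_left ip_smul_right

lemma ip_commute_zero: "ip x y = 0 \<longleftrightarrow> ip y x = 0"
  by (metis ip_sconj sconj_0)

lemma norm_eq_if_ip_eq: "ip x x = ip y y \<Longrightarrow> norm x = norm y"
  unfolding ip_norm of_real_eq_iff by simp

lemma ip_self_zero [simp]: "ip x x = 0 \<longleftrightarrow> x = 0"
  by (simp add: ip_norm)

lemma norm_smul [simp]: "norm (smul a x) = norm a * norm x"
proof -
  have "of_real ((norm (smul a x))\<^sup>2) = (of_real ((norm a * norm x)\<^sup>2) :: 'k)"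
    using mult_sconj[of a] ip_norm[of x]
    by (simp only: ip_norm[symmetric, of "smul a x"] ip_smul_left ip_smul_right)
      (simp add: scaleR_conv_of_real power_mult_distrib ac_simps)
  then show ?thesis unfolding of_real_eq_iff by simp
qed

lemma bounded_linear_smul: "bounded_linear (smul a)"
proof (rule bounded_linear_intro[where K = "norm a"])
  show "smul a (r *\<^sub>R x) = r *\<^sub>R smul a x" for r x
    by (metis scale_left_commute smul_of_real)
qed (simp_all add: scale_right_distrib mult.commute)

text \<open>Pythagoras: after removing its component along \<open>y\<close>, the rest of
  \<open>x\<close> is orthogonal to \<open>y\<close>. For \<open>y = 0\<close> the zero value of
  division by zero keeps the identity true. It yields both Cauchy-Schwarz and the orthogonality of
  nearest points.\<close>

lemma norm_diff_component:
  "(norm (x - smul (ip x y / of_real ((norm y)\<^sup>2)) y))\<^sup>2 = (norm x)\<^sup>2 - (norm (ip x y))\<^sup>2 / (norm y)\<^sup>2"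
proof (cases "y = 0")
  case False
  define c where "c = ip x y / of_real ((norm y)\<^sup>2)"
  have c: "c * of_real ((norm y)\<^sup>2) = ip x y"
    using False by (simp add: c_def)
  then have "ip (x - smul c y) y = 0"
    by (simp add: ip_simps ip_norm)
  then have "ip (x - smul c y) (x - smul c y) = ip (x - smul c y) x"
    by (simp only: ip_diff_right ip_smul_right) simp
  also have "\<dots> = of_real ((norm x)\<^sup>2) - c * sconj (ip x y)"
    by (simp only: ip_diff_left ip_smul_left ip_norm ip_sconj[of y x])
  also have "c * sconj (ip x y) = of_real ((norm (ip x y))\<^sup>2 / (norm y)\<^sup>2)"
    using mult_sconj[of "ip x y"] by (simp add: c_def scaleR_conv_of_real)
  finally have "of_real ((norm (x - smul c y))\<^sup>2)
      = (of_real ((norm x)\<^sup>2 - (norm (ip x y))\<^sup>2 / (norm y)\<^sup>2) :: 'k)"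
    unfolding ip_norm by simp
  then show ?thesis unfolding c_def of_real_eq_iff .
qed simp

text \<open>Cauchy-Schwarz: the left side of \<open>norm_diff_component\<close> is
  non-negative.\<close>

lemma norm_ip_le: "norm (ip x y) \<le> norm x * norm y"
proof (cases "y = 0")
  case False
  have "0 \<le> (norm x)\<^sup>2 - (norm (ip x y))\<^sup>2 / (norm y)\<^sup>2"
    unfolding norm_diff_component[symmetric] by simp
  then have "(norm (ip x y))\<^sup>2 \<le> (norm x * norm y)\<^sup>2"
    using False by (simp add: field_simps)
  then show ?thesis by (rule power2_le_imp_le) simp
qed simp

lemma bounded_linear_ip_left: "bounded_linear (\<lambda>x. ip x y)"
proof (rule bounded_linear_intro[where K = "norm y"])
  show "ip (r *\<^sub>R x) y = r *\<^sub>R ip x y" for r x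
    by (metis ip_smul_left smul_of_real scaleR_conv_of_real)
qed (simp_all add: ip_add_left norm_ip_le)

lemma bounded_linear_ip_right: "bounded_linear (ip x)"
  using bounded_linear_compose[OF bounded_linear_sconj bounded_linear_ip_left[of x]]
  by (simp flip: ip_sconj)

lemma parallelogram:
  fixes x y :: 'a
  shows "(norm (x + y))\<^sup>2 + (norm (x - y))\<^sup>2 = 2 * (norm x)\<^sup>2 + 2 * (norm y)\<^sup>2"
proof -
  have "ip (x + y) (x + y) + ip (x - y) (x - y) = 2 * ip x x + 2 * ip y y"
    by (simp add: ip_simps)
  then have "of_real ((norm (x + y))\<^sup>2 + (norm (x - y))\<^sup>2)
      = (of_real (2 * (norm x)\<^sup>2 + 2 * (norm y)\<^sup>2) :: 'k)"
    unfolding ip_norm by simp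
  then show ?thesis unfolding of_real_eq_iff .
qed

lemma subspace_scaleR: "subspace X \<Longrightarrow> x \<in> X \<Longrightarrow> r *\<^sub>R x \<in> X"
  by (metis smul_of_real subspace_scale)

lemma closure_subspace_smul:
  assumes "subspace X"
  shows "subspace (closure X)"
proof (rule subspaceI)
  show "0 \<in> closure X"
    using subspace_0[OF assms] closure_subset by blast
  show "x + y \<in> closure X" if xy: "x \<in> closure X" "y \<in> closure X" for x y
  proof -
    obtain f g where "\<And>n. f n \<in> X" "f \<longlonglongrightarrow> x" "\<And>n. g n \<in> X" "g \<longlonglongrightarrow> y"
      using xy unfolding closure_sequential by metis
    then show ?thesis
      unfolding closure_sequential
      by (intro exI[of _ "\<lambda>n. f n + g n"]) (simp add: tendsto_add subspace_add[OF assms])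
  qed
  show "smul c x \<in> closure X" if x: "x \<in> closure X" for c x
  proof -
    obtain f where "\<And>n. f n \<in> X" "f \<longlonglongrightarrow> x"
      using x unfolding closure_sequential by metis
    then show ?thesis
      unfolding closure_sequential
      by (intro exI[of _ "\<lambda>n. smul c (f n)"])
        (simp add: bounded_linear.tendsto[OF bounded_linear_smul] subspace_scale[OF assms])
  qed
qed

text \<open>The vectors orthogonal to \<open>u\<close> form a closed subspace, so it is enough to
  test generators.\<close>

lemma orthogonal_closure_span:
  assumes "\<And>s. s \<in> S \<Longrightarrow> ip u s = 0" and "x \<in> closure (span S)"
  shows "ip u x = 0"
proof -
  have "subspace {x. ip u x = 0}"
    by (auto simp: subspace_def ip_simps)
  then have "span S \<subseteq> {x. ip u x = 0}"
    using assms(1) by (intro span_minimal) auto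
  moreover have "closed {x. ip u x = 0}"
    by (intro closed_Collect_eq linear_continuous_on bounded_linear_ip_right continuous_on_const)
  ultimately show ?thesis
    using assms(2) closure_minimal by blast
qed

section \<open>Nearest points and orthogonal projections\<close>

text \<open>The parallelogram law makes every minimizing sequence Cauchy; completeness and
  closedness of \<open>X\<close> then supply the nearest point.\<close>

lemma minimizer_exists:
  assumes "subspace X" "closed X"
  shows "\<exists>p\<in>X. \<forall>x\<in>X. norm (f - p) \<le> norm (f - x)"
proof -
  define d where "d = (INF x\<in>X. norm (f - x))"
  have ne: "X \<noteq> {}" using subspace_0[OF assms(1)] by auto
  have bdd: "bdd_below ((\<lambda>x. norm (f - x)) ` X)"
    by (rule bdd_belowI[of _ 0]) auto
  have d_le: "d \<le> norm (f - x)" if "x \<in> X" for x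
    unfolding d_def by (rule cINF_lower[OF bdd that])
  have "0 \<le> d"
    unfolding d_def by (rule cINF_greatest[OF ne]) simp
  have "\<exists>x\<in>X. norm (f - x) < d + 1 / real (Suc n)" for n
  proof (rule ccontr)
    assume "\<not> ?thesis"
    then have "d + 1 / real (Suc n) \<le> d"
      unfolding d_def by (intro cINF_greatest[OF ne]) (auto simp: not_less)
    then show False by simp
  qed
  then obtain s where sX: "s n \<in> X" and s: "norm (f - s n) < d + 1 / real (Suc n)" for n
    by metis
  have lim: "(\<lambda>n. norm (f - s n)) \<longlonglongrightarrow> d"
  proof (rule tendsto_sandwich[where f = "\<lambda>_. d"])
    show "(\<lambda>n. d + 1 / real (Suc n)) \<longlonglongrightarrow> d"
      using tendsto_add[OF tendsto_const LIMSEQ_inverse_real_of_nat, of d]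
      by (simp add: inverse_eq_divide)
  qed (use d_le[OF sX] less_imp_le[OF s] in simp_all)
  \<comment> \<open>The midpoint of \<open>s m\<close> and \<open>s n\<close> lies in
    \<open>X\<close>, hence at distance at least \<open>d\<close> from \<open>f\<close>. This bounds
    the sum term of the parallelogram law below by \<open>4 * d^2\<close>.\<close>
  have dist: "(norm (s m - s n))\<^sup>2 \<le> 2 * (norm (f - s m))\<^sup>2 + 2 * (norm (f - s n))\<^sup>2 - 4 * d\<^sup>2" for m n
  proof -
    have "(1/2) *\<^sub>R (s m + s n) \<in> X"
      using sX assms(1) by (intro subspace_scaleR subspace_add)
    then have "d \<le> norm (f - (1/2) *\<^sub>R (s m + s n))"
      by (rule d_le)
    also have "f - (1/2) *\<^sub>R (s m + s n) = (1/2) *\<^sub>R ((f - s m) + (f - s n))"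
      by (simp add: algebra_simps flip: scaleR_left.add)
    finally have "2 * d \<le> norm ((f - s m) + (f - s n))" by simp
    then have "(2 * d)\<^sup>2 \<le> (norm ((f - s m) + (f - s n)))\<^sup>2"
      using \<open>0 \<le> d\<close> by (intro power_mono) auto
    moreover have "norm ((f - s m) - (f - s n)) = norm (s m - s n)"
      by (simp add: norm_minus_commute)
    ultimately show ?thesis
      using parallelogram[of "f - s m" "f - s n"] by (simp add: power_mult_distrib)
  qed
  have "Cauchy s"
  proof (rule metric_CauchyI)
    fix e :: real assume "0 < e"
    have "(\<lambda>n. (norm (f - s n))\<^sup>2) \<longlonglongrightarrow> d\<^sup>2"
      by (intro tendsto_power lim)
    \<comment> \<open>The margin \<open>e^2 / 4\<close> enters \<open>dist\<close> twice with factor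
      2, and \<open>4 * d^2\<close> cancels, which leaves exactly \<open>e^2\<close>.\<close>
    then have "\<forall>\<^sub>F n in sequentially. (norm (f - s n))\<^sup>2 < d\<^sup>2 + e\<^sup>2 / 4"
      by (rule order_tendstoD) (use \<open>0 < e\<close> in simp)
    then obtain N where N: "(norm (f - s n))\<^sup>2 < d\<^sup>2 + e\<^sup>2 / 4" if "n \<ge> N" for n
      unfolding eventually_sequentially by auto
    have "dist (s m) (s n) < e" if "m \<ge> N" "n \<ge> N" for m n
    proof -
      have "(norm (s m - s n))\<^sup>2 < e\<^sup>2"
        using dist[of m n] N[OF that(1)] N[OF that(2)] by simp
      then show ?thesis
        using \<open>0 < e\<close> by (simp add: dist_norm power2_less_imp_less)
    qed
    then show "\<exists>M. \<forall>m\<ge>M. \<forall>n\<ge>M. dist (s m) (s n) < e" by blast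
  qed
  then obtain p where p: "s \<longlonglongrightarrow> p"
    using Cauchy_convergent convergent_def by blast
  have "p \<in> X"
    using assms(2) sX p closed_sequentially by blast
  moreover have "norm (f - p) = d"
    by (rule LIMSEQ_unique[OF _ lim]) (intro tendsto_norm tendsto_diff tendsto_const p)
  ultimately show ?thesis
    using d_le by metis
qed

lemma orth_decomposition:
  assumes "subspace X" "closed X"
  shows "\<exists>p\<in>X. \<forall>x\<in>X. ip (f - p) x = 0"
proof -
  obtain p where p: "p \<in> X" and min: "\<And>x. x \<in> X \<Longrightarrow> norm (f - p) \<le> norm (f - x)"
    using minimizer_exists[OF assms] by blast
  have "ip (f - p) x = 0" if "x \<in> X" for x
  proof (cases "x = 0")
    case False
    \<comment> \<open>If \<open>f - p\<close> had a non-zero component along \<open>x\<close>,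
      moving \<open>p\<close> by that component would bring it strictly closer to
      \<open>f\<close>.\<close>
    define c where "c = ip (f - p) x / of_real ((norm x)\<^sup>2)"
    have "norm (f - p) \<le> norm (f - (p + smul c x))"
      by (intro min subspace_add subspace_scale assms p that)
    then have "(norm (f - p))\<^sup>2 \<le> (norm ((f - p) - smul c x))\<^sup>2"
      by (simp add: diff_diff_eq power_mono)
    then have "(norm (ip (f - p) x))\<^sup>2 / (norm x)\<^sup>2 \<le> 0"
      unfolding c_def norm_diff_component by simp
    then show ?thesis
      using False by (simp add: divide_le_0_iff)
  qed simp
  then show ?thesis using p by blast
qed

text \<open>For two candidates \<open>p\<close> and \<open>q\<close>, the vector
  \<open>q - p\<close> lies in \<open>X\<close> and is orthogonal to both \<open>f - p\<close> and
  \<open>f - q\<close>, hence to itself. Projections are computed below by checking these two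
  conditions.\<close>

lemma orth_proj_eqI:
  assumes "subspace X" "p \<in> X" "\<And>x. x \<in> X \<Longrightarrow> ip (f - p) x = 0"
  shows "orth_proj ip X f = p"
  unfolding orth_proj_def
proof (rule the_equality)
  fix q assume q: "q \<in> X \<and> (\<forall>x\<in>X. ip (f - q) x = 0)"
  then have "q - p \<in> X" using assms by (intro subspace_diff) auto
  then have "ip (f - p) (q - p) - ip (f - q) (q - p) = 0"
    using q assms by simp
  then have "ip (q - p) (q - p) = 0" by (simp add: ip_simps algebra_simps)
  then show "q = p" by simp
qed (use assms in auto)

lemma orth_proj_props:
  assumes "closed_subspace smul X"
  shows orth_proj_in: "orth_proj ip X f \<in> X"
    and orth_proj_orthogonal: "x \<in> X \<Longrightarrow> ip (f - orth_proj ip X f) x = 0"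
proof -
  have X: "subspace X" "closed X" using assms by (auto simp: closed_subspace_def)
  obtain p where "p \<in> X" "\<And>x. x \<in> X \<Longrightarrow> ip (f - p) x = 0"
    using orth_decomposition[OF X] by blast
  then show "orth_proj ip X f \<in> X" "x \<in> X \<Longrightarrow> ip (f - orth_proj ip X f) x = 0"
    using orth_proj_eqI[OF X(1)] by auto
qed

section \<open>Riesz representation, adjoints and unitary operators\<close>

lemma riesz_representation:
  fixes \<phi> :: "'a \<Rightarrow> 'k"
  assumes "bounded_linear \<phi>" and smul: "\<And>a x. \<phi> (smul a x) = a * \<phi> x"
  shows "\<exists>z. \<forall>x. \<phi> x = ip x z"
proof (cases "\<forall>u. \<phi> u = 0")
  case True
  then show ?thesis by (auto intro: exI[of _ 0])
next
  case False
  then obtain u where u: "\<phi> u \<noteq> 0" by blast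
  interpret bounded_linear \<phi> by fact
  have N: "subspace {x. \<phi> x = 0}"
    by (auto simp: subspace_def add smul zero)
  have "closed {x. \<phi> x = 0}"
    by (intro closed_Collect_eq linear_continuous_on assms continuous_on_const)
  then obtain p where p: "\<phi> p = 0" and orth: "\<And>x. \<phi> x = 0 \<Longrightarrow> ip (u - p) x = 0"
    using orth_decomposition[OF N] by blast
  \<comment> \<open>A non-zero vector orthogonal to the kernel of \<open>\<phi>\<close>; the
    representing vector is a multiple of it.\<close>
  define z where "z = u - p"
  have "\<phi> z \<noteq> 0" using u p by (simp add: z_def diff)
  then have "z \<noteq> 0" using zero by auto
  \<comment> \<open>The factor is forced by taking \<open>x = z\<close>; it is conjugated because
    \<open>ip\<close> is conjugate-linear in its second argument.\<close>
  have "\<phi> x = ip x (smul (sconj (\<phi> z / ip z z)) z)" for x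
  proof -
    \<comment> \<open>This combination is annihilated by \<open>\<phi>\<close>, so it is orthogonal
      to \<open>z\<close>.\<close>
    have "ip z (smul (\<phi> z) x - smul (\<phi> x) z) = 0"
      unfolding z_def by (rule orth) (simp add: diff smul)
    then have "ip (smul (\<phi> z) x - smul (\<phi> x) z) z = 0"
      by (rule ip_commute_zero[THEN iffD1])
    then show ?thesis
      using \<open>z \<noteq> 0\<close> by (simp add: ip_simps field_simps)
  qed
  then show ?thesis by blast
qed

text \<open>\<open>adjoint_op\<close> is a definite description, so existence (Riesz, one
  \<open>y\<close> at a time) and uniqueness come first. Then \<open>ip (T x) (T y)\<close> equals
  \<open>ip x (S (T y))\<close> with \<open>S\<close> the adjoint, and
  \<open>S (T y) = y\<close>.\<close>

lemma unitary_op_ip: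
  assumes "unitary_op smul ip T"
  shows "ip (T x) (T y) = ip x y"
proof -
  have bl: "bounded_linear T" and lin: "Vector_Spaces.linear smul smul T"
    using assms by (auto simp: unitary_op_def bounded_op_def)
  have "\<exists>z. \<forall>x. ip (T x) y = ip x z" for y
  proof -
    have "bounded_linear (\<lambda>x. ip (T x) y)"
      by (rule bounded_linear_compose[OF bounded_linear_ip_left bl])
    moreover have "ip (T (smul a x)) y = a * ip (T x) y" for a x
      by (simp add: module_hom.scale[OF module_hom_linearI[OF lin]] ip_smul_left)
    ultimately show ?thesis by (rule riesz_representation)
  qed
  then obtain S where S: "\<And>x y. ip (T x) y = ip x (S y)" by metis
  have "adjoint_op ip T = S"
    unfolding adjoint_op_def
  proof (rule the_equality)
    fix S' assume S': "\<forall>x y. ip (T x) y = ip x (S' y)"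
    have "ip (S' y - S y) (S' y - S y) = 0" for y
      using S S' by (simp add: ip_diff_right)
    then show "S' = S" by auto
  qed (simp add: S)
  then have "S (T y) = y"
    using assms by (metis unitary_op_def comp_apply id_apply)
  then show ?thesis using S by metis
qed

section \<open>Extending isometries from a family with dense span\<close>

text \<open>Equal Gram matrices force every linear relation among the \<open>s i\<close> to hold
  among the \<open>t i\<close>. The domain of the extension is a closed subspace containing all
  \<open>s i\<close>, hence the whole space.\<close>

lemma isometric_extension:
  fixes s t :: "'i \<Rightarrow> 'a"
  assumes st: "\<And>i j. ip (t i) (t j) = ip (s i) (s j)" and dense: "closure (span (range s)) = UNIV"
  shows "\<exists>R. bounded_op smul R \<and> (\<forall>i. R (s i) = t i) \<and> (\<forall>x y. ip (R x) (R y) = ip x y)"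
proof -
  define Y where "Y = closure (span (range t))"
  have Y: "subspace Y"
    unfolding Y_def by (intro closure_subspace_smul subspace_span)
  \<comment> \<open>\<open>rel\<close> is the graph of the extension, written so that closedness, linearity and
    single-valuedness are immediate; \<open>good\<close> carries the isometry property through the density
    argument.\<close>
  define rel where "rel x y \<longleftrightarrow> y \<in> Y \<and> (\<forall>i. ip y (t i) = ip x (s i))" for x y
  define good where "good x y \<longleftrightarrow> rel x y \<and> (\<forall>x' y'. rel x' y' \<longrightarrow> ip y' y = ip x' x)" for x y
  \<comment> \<open>The difference lies in the closed span of the \<open>t i\<close> and is
    orthogonal to each of them, hence to itself.\<close>
  have rel_unique: "y = y'" if "rel x y" "rel x y'" for x y y'
  proof -
    have "y - y' \<in> closure (span (range t))"
      using that subspace_diff[OF Y] unfolding rel_def Y_def by blast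
    moreover have "ip (y - y') (t i) = 0" for i
      using that by (simp add: rel_def ip_diff_left)
    ultimately have "ip (y - y') (y - y') = 0"
      by (elim orthogonal_closure_span[rotated]) auto
    then show ?thesis by simp
  qed
  have good_0: "good 0 0"
    using Y by (simp add: good_def rel_def subspace_0)
  have rel_add: "rel (x + x') (y + y')" and rel_diff: "rel (x - x') (y - y')"
    if "rel x y" "rel x' y'" for x x' y y'
    using that subspace_add[OF Y] subspace_diff[OF Y] by (auto simp: rel_def ip_simps)
  have rel_smul: "rel (smul a x) (smul a y)" if "rel x y" for a x y
    using that subspace_scale[OF Y] by (auto simp: rel_def ip_simps)
  have good_add: "good (x + x') (y + y')" and good_diff: "good (x - x') (y - y')"
    if "good x y" "good x' y'" for x x' y y'
    using that rel_add rel_diff by (auto simp: good_def ip_simps)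
  have good_smul: "good (smul a x) (smul a y)" if "good x y" for a x y
    using that rel_smul by (auto simp: good_def ip_simps)
  \<comment> \<open>For the pair \<open>s i\<close>, \<open>t i\<close> the isometry clause of
    \<open>good\<close> is one of the equations defining \<open>rel\<close>.\<close>
  have good_st: "good (s i) (t i)" for i
  proof -
    have "t i \<in> Y"
      unfolding Y_def by (intro subsetD[OF closure_subset] span_base rangeI)
    then show ?thesis by (simp add: good_def rel_def st)
  qed
  have good_norm: "norm y = norm x" if "good x y" for x y
    using that by (intro norm_eq_if_ip_eq) (simp add: good_def)
  \<comment> \<open>Since \<open>good\<close> pairs preserve distances, a convergent sequence of
    arguments has Cauchy images. Their limit satisfies all the equations by continuity of
    \<open>ip\<close>.\<close>
  have "closed {x. \<exists>y. good x y}"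
    unfolding closed_sequential_limits
  proof (intro allI impI, elim conjE)
    fix u x assume "\<forall>n. u n \<in> {x. \<exists>y. good x y}" and u: "u \<longlonglongrightarrow> x"
    then obtain r where r: "\<And>n. good (u n) (r n)"
      by (auto simp: choice_iff)
    have "dist (r m) (r n) = dist (u m) (u n)" for m n
      using good_norm[OF good_diff[OF r r]] by (simp add: dist_norm)
    then have "Cauchy r"
      using LIMSEQ_imp_Cauchy[OF u] by (simp add: Cauchy_def)
    then obtain y where y: "r \<longlonglongrightarrow> y"
      using Cauchy_convergent convergent_def by blast
    have "y \<in> Y"
      by (rule closed_sequentially[OF _ _ y]) (use r in \<open>auto simp: Y_def good_def rel_def\<close>)
    moreover have "ip y (t i) = ip x (s i)" for i
    proof (rule LIMSEQ_unique)
      show "(\<lambda>n. ip (r n) (t i)) \<longlonglongrightarrow> ip y (t i)"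
        by (rule bounded_linear.tendsto[OF bounded_linear_ip_left y])
      show "(\<lambda>n. ip (r n) (t i)) \<longlonglongrightarrow> ip x (s i)"
        using bounded_linear.tendsto[OF bounded_linear_ip_left u, of "s i"] r
        by (simp add: good_def rel_def)
    qed
    moreover have "ip y' y = ip x' x" if "rel x' y'" for x' y'
    proof (rule LIMSEQ_unique)
      show "(\<lambda>n. ip y' (r n)) \<longlonglongrightarrow> ip y' y"
        by (rule bounded_linear.tendsto[OF bounded_linear_ip_right y])
      show "(\<lambda>n. ip y' (r n)) \<longlonglongrightarrow> ip x' x"
        using bounded_linear.tendsto[OF bounded_linear_ip_right u, of x'] r that
        by (simp add: good_def)
    qed
    ultimately show "x \<in> {x. \<exists>y. good x y}"
      by (auto simp: good_def rel_def)
  qed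
  moreover have "subspace {x. \<exists>y. good x y}"
    using good_0 good_add good_smul by (auto simp: subspace_def) blast+
  then have "span (range s) \<subseteq> {x. \<exists>y. good x y}"
    using good_st by (intro span_minimal) auto
  ultimately have "\<exists>y. good x y" for x
    using closure_minimal dense by blast
  then obtain R where R: "\<And>x. good x (R x)" by metis
  have R_eq: "R x = y" if "good x y" for x y
    using rel_unique R that unfolding good_def by blast
  have R_add: "R (x + y) = R x + R y" and R_smul: "R (smul a x) = smul a (R x)" for x y a
    by (rule R_eq, intro good_add good_smul R)+
  have "bounded_linear R"
  proof (rule bounded_linear_intro[where K = 1])
    show "R (r *\<^sub>R x) = r *\<^sub>R R x" for r x
      by (metis R_smul smul_of_real)
  qed (simp_all add: R_add good_norm[OF R])
  moreover have "Vector_Spaces.linear smul smul R"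
    by (simp add: Vector_Spaces.linear_iff vector_space_axioms R_add R_smul)
  moreover have "ip (R x) (R y) = ip x y" for x y
    using R unfolding good_def by blast
  ultimately show ?thesis
    using R_eq[OF good_st] unfolding bounded_op_def by blast
qed

text \<open>The set where two bounded operators agree is a closed subspace. This gives the
  uniqueness behind the description in \<open>tensor_op\<close>.\<close>

lemma bounded_op_eq_on_dense:
  assumes "bounded_op smul R" "bounded_op smul R'" "closure (span S) = UNIV"
    and "\<And>x. x \<in> S \<Longrightarrow> R x = R' x"
  shows "R = R'"
proof
  fix x
  have "subspace {x. R x = R' x}"
    using assms(1,2) by (auto simp: bounded_op_def subspace_def Vector_Spaces.linear_iff
        bounded_linear.linear linear_0)
  then have "span S \<subseteq> {x. R x = R' x}"
    using assms(4) by (intro span_minimal) auto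
  moreover have "closed {x. R x = R' x}"
    using assms(1,2) by (intro closed_Collect_eq linear_continuous_on) (auto simp: bounded_op_def)
  ultimately show "R x = R' x"
    using assms(3) closure_minimal by blast
qed

section \<open>Isometric images of closed subspaces and their projections\<close>

text \<open>Closed means complete here, and isometries preserve completeness.\<close>

lemma closed_subspace_isometric_image:
  assumes "closed_subspace smul X" "bounded_op smul R" "\<And>x y. ip (R x) (R y) = ip x y"
  shows "closed_subspace smul (R ` X)"
proof -
  have X: "subspace X" "closed X" and R: "Vector_Spaces.linear smul smul R" "bounded_linear R"
    using assms by (auto simp: closed_subspace_def bounded_op_def)
  have "Real_Vector_Spaces.subspace X"
    using X(1) by (auto simp: Real_Vector_Spaces.subspace_def subspace_0 subspace_add subspace_scaleR)
  moreover have "norm (R x) = norm x" for x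
    by (rule norm_eq_if_ip_eq[OF assms(3)])
  ultimately have "complete (R ` X)"
    using X(2) R(2) by (intro complete_isometric_image[of 1]) (auto simp: complete_eq_closed)
  moreover have "subspace (R ` X)"
    by (rule module_hom.subspace_image[OF module_hom_linearI[OF R(1)] X(1)])
  ultimately show ?thesis
    by (simp add: closed_subspace_def complete_eq_closed)
qed

text \<open>The residual \<open>R u - R (orth_proj ip X u)\<close> is tested only against vectors
  \<open>R x\<close> with \<open>x\<close> in \<open>X\<close>, where the isometry reduces
  orthogonality to that of the original residual.\<close>

lemma orth_proj_isometric_image:
  assumes X: "closed_subspace smul X" and R: "bounded_op smul R"
    and iso: "\<And>x y. ip (R x) (R y) = ip x y"
  shows "orth_proj ip (R ` X) (R u) = R (orth_proj ip X u)"
proof (rule orth_proj_eqI)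
  show "subspace (R ` X)"
    using closed_subspace_isometric_image[OF assms] by (simp add: closed_subspace_def)
  show "R (orth_proj ip X u) \<in> R ` X"
    using orth_proj_in[OF X] by blast
  fix y assume "y \<in> R ` X"
  then obtain x where "x \<in> X" "y = R x" by blast
  then show "ip (R u - R (orth_proj ip X u)) y = 0"
    using orth_proj_orthogonal[OF X, of x u] by (simp add: iso ip_diff_left)
qed

end

section \<open>Tensor products\<close>

context hilbert_tensor
begin

lemma norm_tensor: "norm (tensor f g) = norm f * norm g"
proof -
  have "of_real ((norm (tensor f g))\<^sup>2) = (of_real ((norm f * norm g)\<^sup>2) :: 'k)"
    using ip_tensor[of f g f g]
    by (simp only: H.ip_norm K.ip_norm HK.ip_norm power_mult_distrib of_real_mult)
  then show ?thesis unfolding of_real_eq_iff by simp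
qed

lemma closed_subspace_tensor_subspace: "closed_subspace smulHK (tensor_subspace smulHK tensor V W)"
  unfolding closed_subspace_def tensor_subspace_def
  by (intro conjI HK.closure_subspace_smul HK.subspace_span closed_closure)

text \<open>Against a generator of the tensor subspace, \<open>f\<close> and \<open>g\<close> may be
  replaced by their projections in each factor of the inner product. The residual is therefore
  orthogonal to all generators, hence to their closed span.\<close>

lemma orth_proj_tensor_subspace:
  assumes V: "closed_subspace smulH V" and W: "closed_subspace smulK W"
  shows "orth_proj ipHK (tensor_subspace smulHK tensor V W) (tensor f g)
    = tensor (orth_proj ipH V f) (orth_proj ipK W g)"
proof (rule HK.orth_proj_eqI)
  let ?S = "{tensor f g |f g. f \<in> V \<and> g \<in> W}"
  show "HK.subspace (tensor_subspace smulHK tensor V W)"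
    using closed_subspace_tensor_subspace by (simp add: closed_subspace_def)
  have "tensor (orth_proj ipH V f) (orth_proj ipK W g) \<in> ?S"
    using H.orth_proj_in[OF V] K.orth_proj_in[OF W] by blast
  then show "tensor (orth_proj ipH V f) (orth_proj ipK W g) \<in> tensor_subspace smulHK tensor V W"
    unfolding tensor_subspace_def by (intro subsetD[OF closure_subset] HK.span_base)
  fix x assume x: "x \<in> tensor_subspace smulHK tensor V W"
  show "ipHK (tensor f g - tensor (orth_proj ipH V f) (orth_proj ipK W g)) x = 0"
  proof (rule HK.orthogonal_closure_span)
    show "x \<in> closure (HK.span ?S)" using x by (simp add: tensor_subspace_def)
    fix y assume "y \<in> ?S"
    then obtain f' g' where y: "y = tensor f' g'" "f' \<in> V" "g' \<in> W" by blast
    then have "ipH f f' = ipH (orth_proj ipH V f) f'" "ipK g g' = ipK (orth_proj ipK W g) g'"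
      using H.orth_proj_orthogonal[OF V, of f' f] K.orth_proj_orthogonal[OF W, of g' g]
      by (simp_all add: H.ip_diff_left K.ip_diff_left)
    then show "ipHK (tensor f g - tensor (orth_proj ipH V f) (orth_proj ipK W g)) y = 0"
      by (simp add: y HK.ip_diff_left ip_tensor)
  qed
qed

text \<open>Elementary tensors, indexed by pairs, and their images have equal Gram matrices, so the
  isometric extension exists; density of their span makes it the operator described by
  \<open>tensor_op\<close>.\<close>

lemma tensor_op_unitary:
  assumes "unitary_op smulH ipH Q" "unitary_op smulK ipK T"
  shows tensor_op_bounded: "bounded_op smulHK (tensor_op smulHK tensor Q T)"
    and tensor_op_tensor: "tensor_op smulHK tensor Q T (tensor f g) = tensor (Q f) (T g)"
    and tensor_op_ip:
      "ipHK (tensor_op smulHK tensor Q T x) (tensor_op smulHK tensor Q T y) = ipHK x y"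
proof -
  have S: "range (\<lambda>(f, g). tensor f g) = {tensor f g |f g. True}" by auto
  have "\<exists>R. bounded_op smulHK R \<and> (\<forall>p. R (case p of (f, g) \<Rightarrow> tensor f g)
        = (case p of (f, g) \<Rightarrow> tensor (Q f) (T g))) \<and> (\<forall>x y. ipHK (R x) (R y) = ipHK x y)"
  proof (rule HK.isometric_extension)
    show "closure (HK.span (range (\<lambda>(f, g). tensor f g))) = UNIV"
      unfolding S by (rule tensor_dense)
  qed (auto simp: ip_tensor H.unitary_op_ip[OF assms(1)] K.unitary_op_ip[OF assms(2)])
  then obtain R where R: "bounded_op smulHK R" "\<And>f g. R (tensor f g) = tensor (Q f) (T g)"
    and iso: "\<And>x y. ipHK (R x) (R y) = ipHK x y" by auto
  have "tensor_op smulHK tensor Q T = R"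
    unfolding tensor_op_def
  proof (rule the_equality)
    fix R' assume "bounded_op smulHK R' \<and> (\<forall>f g. R' (tensor f g) = tensor (Q f) (T g))"
    then show "R' = R"
      using R by (intro HK.bounded_op_eq_on_dense[OF _ _ tensor_dense]) auto
  qed (use R in auto)
  then show "bounded_op smulHK (tensor_op smulHK tensor Q T)"
    "tensor_op smulHK tensor Q T (tensor f g) = tensor (Q f) (T g)"
    "ipHK (tensor_op smulHK tensor Q T x) (tensor_op smulHK tensor Q T y) = ipHK x y"
    using R iso by auto
qed

end

section \<open>Product sums and the frame bounds\<close>

text \<open>Tonelli for sums: non-negativity turns summability of the iterated sums into joint
  summability, and summing over \<open>j\<close> first gives the value.\<close>

lemma has_sum_product_nonneg:
  fixes a :: "'i \<Rightarrow> real" and b :: "'j \<Rightarrow> real"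
  assumes a: "(a has_sum s) I" and b: "(b has_sum t) J"
    and "\<And>i. i \<in> I \<Longrightarrow> 0 \<le> a i" "\<And>j. j \<in> J \<Longrightarrow> 0 \<le> b j"
  shows "((\<lambda>(i, j). a i * b j) has_sum s * t) (I \<times> J)"
proof -
  have inner: "((\<lambda>j. case (i, j) of (i, j) \<Rightarrow> a i * b j) has_sum a i * t) J" for i
    using has_sum_cmult_right[OF b] by simp
  have outer: "((\<lambda>i. a i * t) has_sum s * t) I"
    by (rule has_sum_cmult_left[OF a])
  have "(\<lambda>(i, j). a i * b j) summable_on I \<times> J"
    using assms outer by (intro summable_on_SigmaI[OF inner]) (auto simp: summable_on_def)
  then show ?thesis
    by (rule has_sum_SigmaI[OF inner outer])
qed

theorem theorem3p7:
  fixes smulH :: "'k::rc_field \<Rightarrow> 'a::banach \<Rightarrow> 'a" and ipH :: "'a \<Rightarrow> 'a \<Rightarrow> 'k"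
    and smulK :: "'k \<Rightarrow> 'b::banach \<Rightarrow> 'b" and ipK :: "'b \<Rightarrow> 'b \<Rightarrow> 'k"
    and smulHK :: "'k \<Rightarrow> 'c::banach \<Rightarrow> 'c" and ipHK :: "'c \<Rightarrow> 'c \<Rightarrow> 'k"
    and tensor :: "'a \<Rightarrow> 'b \<Rightarrow> 'c"
    and I :: "'i set" and V :: "'i \<Rightarrow> 'a set" and v :: "'i \<Rightarrow> real"
    and J :: "'j set" and W :: "'j \<Rightarrow> 'b set" and w :: "'j \<Rightarrow> real"
    and A B C D :: real
    and T1 :: "'a \<Rightarrow> 'a" and T2 :: "'b \<Rightarrow> 'b"
  assumes "hilbert_tensor smulH ipH smulK ipK smulHK ipHK tensor"
    and "separable_space (euclidean :: 'a topology)"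
    and "separable_space (euclidean :: 'b topology)"
    and "fusion_frame smulH ipH I V v A B"
    and "fusion_frame smulK ipK J W w C D"
    and "invertible_op smulH T1" and "unitary_op smulH ipH T1"
    and "invertible_op smulK T2" and "unitary_op smulK ipK T2"
  shows "tensor_fusion_frame smulHK ipHK tensor I J
           (\<lambda>i j. tensor_op smulHK tensor T1 T2 ` tensor_subspace smulHK tensor (V i) (W j)) v w"
proof -
  interpret hilbert_tensor smulH ipH smulK ipK smulHK ipHK tensor by fact
  let ?R = "tensor_op smulHK tensor T1 T2"
  let ?X = "\<lambda>i j. tensor_subspace smulHK tensor (V i) (W j)"
  note R = tensor_op_bounded[OF assms(7,9)] tensor_op_ip[OF assms(7,9)]
  have V: "closed_subspace smulH (V i)" "0 < v i" if "i \<in> I" for i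
    using assms(4) that by (auto simp: fusion_frame_def)
  have W: "closed_subspace smulK (W j)" "0 < w j" if "j \<in> J" for j
    using assms(5) that by (auto simp: fusion_frame_def)
  have AC: "0 < A" "A \<le> B" "0 < C" "C \<le> D"
    using assms(4,5) by (auto simp: fusion_frame_def)
  let ?s = "\<lambda>f g (i, j). (v i)\<^sup>2 * (w j)\<^sup>2 * (norm (orth_proj ipHK (?R ` ?X i j) (tensor f g)))\<^sup>2"
  \<comment> \<open>Stated with \<open>has_sum\<close>, so that summability and the value of
    \<open>infsum\<close> can both be read off.\<close>
  have bounds: "\<exists>S. (?s f g has_sum S) (I \<times> J) \<and>
      A * C * (norm (tensor f g))\<^sup>2 \<le> S \<and> S \<le> B * D * (norm (tensor f g))\<^sup>2" for f g
  proof -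
    \<comment> \<open>Invertibility supplies preimages, so \<open>tensor f g\<close> is the image
      under \<open>?R\<close> of \<open>tensor f' g'\<close>.\<close>
    obtain f' g' where f': "T1 f' = f" and g': "T2 g' = g"
      using assms(6,8) unfolding invertible_op_def by (metis comp_apply id_apply)
    have nf: "norm f' = norm f"
      using H.norm_eq_if_ip_eq[OF H.unitary_op_ip[OF assms(7), of f' f']] by (simp add: f')
    have ng: "norm g' = norm g"
      using K.norm_eq_if_ip_eq[OF K.unitary_op_ip[OF assms(9), of g' g']] by (simp add: g')
    define a where "a i = (v i)\<^sup>2 * (norm (orth_proj ipH (V i) f'))\<^sup>2" for i
    define b where "b j = (w j)\<^sup>2 * (norm (orth_proj ipK (W j) g'))\<^sup>2" for j
    have a: "a summable_on I" "A * (norm f)\<^sup>2 \<le> infsum a I" "infsum a I \<le> B * (norm f)\<^sup>2"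
      using assms(4) unfolding fusion_frame_def a_def nf[symmetric] by blast+
    have b: "b summable_on J" "C * (norm g)\<^sup>2 \<le> infsum b J" "infsum b J \<le> D * (norm g)\<^sup>2"
      using assms(5) unfolding fusion_frame_def b_def ng[symmetric] by blast+
    \<comment> \<open>Projecting onto the image under \<open>?R\<close> commutes with
      \<open>?R\<close>, which preserves norms; the projection onto the tensor subspace then splits
      into factors.\<close>
    have "(v i)\<^sup>2 * (w j)\<^sup>2 * (norm (orth_proj ipHK (?R ` ?X i j) (tensor f g)))\<^sup>2 = a i * b j"
      if "i \<in> I" "j \<in> J" for i j
    proof -
      have "norm (orth_proj ipHK (?R ` ?X i j) (tensor f g))
          = norm (orth_proj ipHK (?R ` ?X i j) (?R (tensor f' g')))"
        by (simp add: tensor_op_tensor[OF assms(7,9)] f' g')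
      also have "\<dots> = norm (?R (orth_proj ipHK (?X i j) (tensor f' g')))"
        by (simp only: HK.orth_proj_isometric_image[OF closed_subspace_tensor_subspace R])
      also have "\<dots> = norm (tensor (orth_proj ipH (V i) f') (orth_proj ipK (W j) g'))"
        by (simp only: HK.norm_eq_if_ip_eq[OF R(2)] orth_proj_tensor_subspace[OF V(1) W(1)] that)
      finally show ?thesis
        by (simp add: norm_tensor a_def b_def power_mult_distrib)
    qed
    moreover have "((\<lambda>(i, j). a i * b j) has_sum infsum a I * infsum b J) (I \<times> J)"
      by (intro has_sum_product_nonneg has_sum_infsum a b) (simp_all add: a_def b_def)
    ultimately have sum: "(?s f g has_sum infsum a I * infsum b J) (I \<times> J)"
      by (subst has_sum_cong[where g = "\<lambda>(i, j). a i * b j"]) auto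
    \<comment> \<open>All quantities are non-negative, so the two frame inequalities can be
      multiplied.\<close>
    have "A * (norm f)\<^sup>2 * (C * (norm g)\<^sup>2) \<le> infsum a I * infsum b J"
      using a b AC by (intro mult_mono) (auto intro: order_trans[rotated])
    moreover have "infsum a I * infsum b J \<le> B * (norm f)\<^sup>2 * (D * (norm g)\<^sup>2)"
      using a b AC by (intro mult_mono infsum_nonneg) (auto simp: b_def)
    ultimately show ?thesis
      using sum by (intro exI[of _ "infsum a I * infsum b J"])
        (simp add: norm_tensor power_mult_distrib ac_simps)
  qed
  show ?thesis
    unfolding tensor_fusion_frame_def Let_def
  proof (intro conjI ballI)
    show "closed_subspace smulHK (?R ` ?X i j)" for i j
      by (rule HK.closed_subspace_isometric_image[OF closed_subspace_tensor_subspace R])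
    show "0 < v i * w j" if "i \<in> I" "j \<in> J" for i j
      using V(2) W(2) that by simp
    \<comment> \<open>The bounds \<open>A * C\<close> and \<open>B * D\<close> serve all elementary
      tensors at once.\<close>
    have "0 < A * C" "A * C \<le> B * D"
      using AC by (auto intro: mult_mono)
    moreover have "?s f g summable_on I \<times> J \<and>
        A * C * (norm (tensor f g))\<^sup>2 \<le> infsum (?s f g) (I \<times> J) \<and>
        infsum (?s f g) (I \<times> J) \<le> B * D * (norm (tensor f g))\<^sup>2" for f g
    proof -
      obtain S where S: "(?s f g has_sum S) (I \<times> J)" "A * C * (norm (tensor f g))\<^sup>2 \<le> S"
          "S \<le> B * D * (norm (tensor f g))\<^sup>2"
        using bounds[of f g] by blast
      then show ?thesis
        using has_sum_imp_summable[OF S(1)] by (simp only: infsumI[OF S(1)] simp_thms)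
    qed
    ultimately show "\<exists>A' B'. 0 < A' \<and> A' \<le> B' \<and> (\<forall>f g. ?s f g summable_on I \<times> J \<and>
        A' * (norm (tensor f g))\<^sup>2 \<le> infsum (?s f g) (I \<times> J) \<and>
        infsum (?s f g) (I \<times> J) \<le> B' * (norm (tensor f g))\<^sup>2)"
      by blast
  qed
qed

end
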